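(* Consider an $M$-dimensional quantum system with $n$ measurements and outcome variables $Y_1,\dots,Y_n$ with joint probability mass function $p(y_1,\dots,y_n)$, and let $\rho_k$ and $\tilde\rho_k$ be the (normalized) pre- and post-measurement density matrices, all as defined in the context. Let $1\le k\le n$ and suppose that the $k$-th measurement is of the general type with matrices $A_k(y)$, $y\in\mathcal{Y}_k$. Let $y_1,\dots,y_{k-1}$ be outcomes with $P(Y_1=y_1,\dots,Y_{k-1}=y_{k-1})>0$. Then for every $y\in\mathcal{Y}_k$, $$P(Y_k=y\mid Y_{k-1}=y_{k-1},\dots,Y_1=y_1)=\operatorname{tr}\!\left(A_k(y)\,\rho_k\,A_k(y)^{\mathsf H}\right).$$ Moreover, after observing $Y_k=y$ (where this conditional probability is positive), the density matrix is $$\tilde\rho_k=\frac{A_k(y)\,\rho_k\,A_k(y)^{\mathsf H}}{\operatorname{tr}\!\left(A_k(y)\,\rho_k\,A_k(y)^{\mathsf H}\right)}.$$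
   Context: A matrix $A\in\mathbb{C}^{M\times M}$ is viewed as a function $(x,y)\mapsto A(x,y)$, with row index $x$ and column index $y$. $A^{\mathsf H}$ is the Hermitian transpose, $\overline{\,\cdot\,}$ is complex conjugation, and $I$ is the identity matrix. The equality constraint function is $f_=(x,x')=1$ if $x=x'$ and $0$ otherwise. System. Let $M,n\ge1$ be integers, $p(x_0)$ a probability mass function on $\{1,\dots,M\}$, $U_0,\dots,U_{n-1}\in\mathbb{C}^{M\times M}$ unitary matrices, and for $k=1,\dots,n$ let $f_k(x_k,x_k',\tilde x_k,\tilde x_k',y_k)$ be a measurement factor with $x_k,x_k',\tilde x_k,\tilde x_k'\in\{1,\dots,M\}$ and $y_k$ in a finite set $\mathcal{Y}_k$, of one of two types. (i) Basic projection type: $\mathcal{Y}_k=\{1,\dots,M\}$, and for some unitary $B_k\in\mathbb{C}^{M\times M}$, $$f_k(x_k,x_k',\tilde x_k,\tilde x_k',y)=B_k(\tilde x_k,y)\,\overline{B_k(x_k,y)}\;B_k(x_k',y)\,\overline{B_k(\tilde x_k',y)}.$$ (ii) General type: there are matrices $A_k(y)\in\mathbb{C}^{M\times M}$, $y\in\mathcal{Y}_k$, with $\sum_{y\in\mathcal{Y}_k}A_k(y)^{\mathsf H}A_k(y)=I$, such that $$f_k(x_k,x_k',\tilde x_k,\tilde x_k',y)=A_k(y)(\tilde x_k,x_k)\;\overline{A_k(y)(\tilde x_k',x_k')}.$$ Joint distribution. The joint probability mass function of $Y_1,\dots,Y_n$ is $$p(y_1,\dots,y_n)=\sum p(x_0)\,U_0(x_1,x_0)\overline{U_0(x_1',x_0)}\prod_{j=1}^{n}f_j(x_j,x_j',\tilde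 x_j,\tilde x_j',y_j)\prod_{j=1}^{n-1}U_j(x_{j+1},\tilde x_j)\,\overline{U_j(x_{j+1}',\tilde x_j')}\;f_=(\tilde x_n,\tilde x_n'),$$ where the sum is over $x_0$ and all $x_j,x_j',\tilde x_j,\tilde x_j'$, $1\le j\le n$, each in $\{1,\dots,M\}$ (this function is a probability mass function on $\mathcal{Y}_1\times\cdots\times\mathcal{Y}_n$). $P$ denotes probability with respect to it. Density matrices. For fixed outcomes $y_1,y_2,\dots$, define the $M\times M$ matrices $$C_k(x_k,x_k')=\sum p(x_0)\,U_0(x_1,x_0)\overline{U_0(x_1',x_0)}\prod_{j=1}^{k-1}\Big[f_j(x_j,x_j',\tilde x_j,\tilde x_j',y_j)\,U_j(x_{j+1},\tilde x_j)\,\overline{U_j(x_{j+1}',\tilde x_j')}\Big],$$ where the sum is over $x_0$ and all $x_j,x_j',\tilde x_j,\tilde x_j'$ with $1\le j\le k-1$, and $$D_k(\tilde x_k,\tilde x_k')=\sum p(x_0)\,U_0(x_1,x_0)\overline{U_0(x_1',x_0)}\prod_{j=1}^{k-1}\Big[f_j(x_j,x_j',\tilde x_j,\tilde x_j',y_j)\,U_j(x_{j+1},\tilde x_j)\,\overline{U_j(x_{j+1}',\tilde x_j')}\Big]f_k(x_k,x_k',\tilde x_k,\tilde x_k',y_k),$$ where the sum is over $x_0$, all $x_j,x_j',\tilde x_j,\tilde x_j'$ with $1\le j\le k-1$, and $x_k,x_k'$. The density matrix before the $k$-th measurement (given $y_1,\dots,y_{k-1}$) is $\rho_k=C_k/\operatorname{tr}(C_k)$,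 and the density matrix after observing $Y_k=y_k$ (given $y_1,\dots,y_k$) is $\tilde\rho_k=D_k/\operatorname{tr}(D_k)$; these are defined when the respective trace is nonzero, which is the case when the respective outcomes have positive probability. *)

theory Defs
  imports "HOL-Probability.Probability"
begin

text \<open>
  The index set \<open>{1..M}\<close> is rendered by a finite type \<open>'m\<close> with \<open>M = CARD('m)\<close>, and the matrix
  entry \<open>A(x, y)\<close> is \<open>A $ x $ y\<close> (row index first).
\<close>

definition hermitian_transpose :: "complex^'n^'m \<Rightarrow> complex^'m^'n"  (\<open>(_\<^sup>H)\<close> [1000] 999)
  where "A\<^sup>H = (\<chi> i j. cnj (A $ j $ i))"

definition unitary :: "complex^'m^'m \<Rightarrow> bool"
  where "unitary A \<longleftrightarrow> A\<^sup>H ** A = mat 1 \<and> A ** A\<^sup>H = mat 1"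

definition matrix_div :: "complex^'n^'m \<Rightarrow> complex \<Rightarrow> complex^'n^'m"  (infixl \<open>'/\<^sub>m\<close> 70)
  where "A /\<^sub>m c = (\<chi> i j. A $ i $ j / c)"

text \<open>
  Since a projective measurement has its outcomes in \<open>{1..M}\<close> (the type \<open>'m\<close>), while a general one
  has an arbitrary finite outcome set, outcomes live in the sum type \<open>'m + 'y\<close>.
\<close>

datatype ('m, 'y) measurement =
    Projection "complex^'m^'m"
  | General "'y set" "'y \<Rightarrow> complex^'m^'m"

fun outcomes :: "('m::finite, 'y) measurement \<Rightarrow> ('m + 'y) set" where
  "outcomes (Projection B) = range Inl"
| "outcomes (General Y A) = Inr ` Y"

fun valid_measurement :: "('m::finite, 'y) measurement \<Rightarrow> bool" where
  "valid_measurement (Projection B) \<longleftrightarrow> unitary B"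
| "valid_measurement (General Y A) \<longleftrightarrow> finite Y \<and> (\<Sum>y\<in>Y. (A y)\<^sup>H ** A y) = mat 1"

text \<open>
  Argument order: \<open>factor \<M> x x' \<xi> \<xi>' y\<close>, with \<open>\<xi>\<close> and \<open>\<xi>'\<close> standing for x-tilde and x-tilde-prime.
  The last equation only covers outcomes that do not belong to the measurement.
\<close>

fun factor :: "('m::finite, 'y) measurement \<Rightarrow> 'm \<Rightarrow> 'm \<Rightarrow> 'm \<Rightarrow> 'm \<Rightarrow> 'm + 'y \<Rightarrow> complex" where
  "factor (Projection B) x x' \<xi> \<xi>' (Inl y) =
     B $ \<xi> $ y * cnj (B $ x $ y) * (B $ x' $ y * cnj (B $ \<xi>' $ y))"
| "factor (General Y A) x x' \<xi> \<xi>' (Inr y) = A y $ \<xi> $ x * cnj (A y $ \<xi>' $ x')"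
| "factor _ x x' \<xi> \<xi>' _ = 0"

definition f_eq :: "'m \<Rightarrow> 'm \<Rightarrow> complex"
  where "f_eq x x' = (if x = x' then 1 else 0)"

text \<open>The tuples \<open>(x\<^sub>1, \<dots>, x\<^sub>m)\<close> over which the sums range.\<close>

definition tuples :: "nat \<Rightarrow> (nat \<Rightarrow> 'm) set"
  where "tuples m = {1..m} \<rightarrow>\<^sub>E UNIV"

definition joint_function ::
  "nat \<Rightarrow> 'm pmf \<Rightarrow> (nat \<Rightarrow> complex^'m^'m) \<Rightarrow> (nat \<Rightarrow> ('m::finite, 'y) measurement) \<Rightarrow>
    (nat \<Rightarrow> 'm + 'y) \<Rightarrow> complex"
  where "joint_function n p U \<M> y =
    (\<Sum>x\<^sub>0\<in>UNIV. \<Sum>x\<in>tuples n. \<Sum>x'\<in>tuples n. \<Sum>\<xi>\<in>tuples n. \<Sum>\<xi>'\<in>tuples n.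
      of_real (pmf p x\<^sub>0) * U 0 $ x 1 $ x\<^sub>0 * cnj (U 0 $ x' 1 $ x\<^sub>0)
      * (\<Prod>j=1..n. factor (\<M> j) (x j) (x' j) (\<xi> j) (\<xi>' j) (y j))
      * (\<Prod>j=1..<n. U j $ x (j + 1) $ \<xi> j * cnj (U j $ x' (j + 1) $ \<xi>' j))
      * f_eq (\<xi> n) (\<xi>' n))"

text \<open>
  The joint distribution of \<open>Y\<^sub>1, \<dots>, Y\<^sub>n\<close>: a random outcome tuple \<open>Y\<close> has the coordinates \<open>Y 1, \<dots>, Y n\<close>.
  For valid data, \<^const>\<open>joint_function\<close> is real, nonnegative and sums to one over the product of the outcome
  sets, so that \<^const>\<open>embed_pmf\<close> yields the distribution with exactly these point masses.
\<close>

definition joint_pmf ::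
  "nat \<Rightarrow> 'm pmf \<Rightarrow> (nat \<Rightarrow> complex^'m^'m) \<Rightarrow> (nat \<Rightarrow> ('m::finite, 'y) measurement) \<Rightarrow>
    (nat \<Rightarrow> 'm + 'y) pmf"
  where "joint_pmf n p U \<M> =
    embed_pmf (\<lambda>y. if y \<in> (\<Pi>\<^sub>E j\<in>{1..n}. outcomes (\<M> j)) then Re (joint_function n p U \<M> y) else 0)"

text \<open>
  In \<open>C_mat\<close> and \<open>D_mat\<close> the free indices are put at position \<open>k\<close> of the tuples: \<open>a\<close>, \<open>a'\<close> are the
  values of \<open>x\<^sub>k\<close>, \<open>x\<^sub>k'\<close> in the former, of \<open>\<xi>\<^sub>k\<close>, \<open>\<xi>\<^sub>k'\<close> in the latter.
\<close>

definition prefix_weight ::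
  "'m pmf \<Rightarrow> (nat \<Rightarrow> complex^'m^'m) \<Rightarrow> (nat \<Rightarrow> ('m::finite, 'y) measurement) \<Rightarrow> (nat \<Rightarrow> 'm + 'y) \<Rightarrow> nat \<Rightarrow>
    'm \<Rightarrow> (nat \<Rightarrow> 'm) \<Rightarrow> (nat \<Rightarrow> 'm) \<Rightarrow> (nat \<Rightarrow> 'm) \<Rightarrow> (nat \<Rightarrow> 'm) \<Rightarrow> complex"
  where "prefix_weight p U \<M> y k x\<^sub>0 x x' \<xi> \<xi>' =
    of_real (pmf p x\<^sub>0) * U 0 $ x 1 $ x\<^sub>0 * cnj (U 0 $ x' 1 $ x\<^sub>0)
    * (\<Prod>j=1..k-1. factor (\<M> j) (x j) (x' j) (\<xi> j) (\<xi>' j) (y j)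
                     * U j $ x (j + 1) $ \<xi> j * cnj (U j $ x' (j + 1) $ \<xi>' j))"

definition C_mat ::
  "'m pmf \<Rightarrow> (nat \<Rightarrow> complex^'m^'m) \<Rightarrow> (nat \<Rightarrow> ('m::finite, 'y) measurement) \<Rightarrow> (nat \<Rightarrow> 'm + 'y) \<Rightarrow> nat \<Rightarrow>
    complex^'m^'m"
  where "C_mat p U \<M> y k = (\<chi> a a'.
    \<Sum>x\<^sub>0\<in>UNIV. \<Sum>x\<in>tuples (k - 1). \<Sum>x'\<in>tuples (k - 1). \<Sum>\<xi>\<in>tuples (k - 1). \<Sum>\<xi>'\<in>tuples (k - 1).
      prefix_weight p U \<M> y k x\<^sub>0 (x(k := a)) (x'(k := a')) \<xi> \<xi>')"

definition D_mat ::
  "'m pmf \<Rightarrow> (nat \<Rightarrow> complex^'m^'m) \<Rightarrow> (nat \<Rightarrow> ('m::finite, 'y) measurement) \<Rightarrow> (nat \<Rightarrow> 'm + 'y) \<Rightarrow> nat \<Rightarrow>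
    complex^'m^'m"
  where "D_mat p U \<M> y k = (\<chi> a a'.
    \<Sum>x\<^sub>0\<in>UNIV. \<Sum>x\<in>tuples k. \<Sum>x'\<in>tuples k. \<Sum>\<xi>\<in>tuples (k - 1). \<Sum>\<xi>'\<in>tuples (k - 1).
      prefix_weight p U \<M> y k x\<^sub>0 x x' \<xi> \<xi>' * factor (\<M> k) (x k) (x' k) a a' (y k))"

text \<open>
  The density matrices are meaningful only if the trace is nonzero, which is the case when the observed
  outcomes (\<open>y 1, \<dots>, y (k - 1)\<close>, respectively \<open>y 1, \<dots>, y k\<close>) have positive probability.
\<close>

definition density_before ::
  "'m pmf \<Rightarrow> (nat \<Rightarrow> complex^'m^'m) \<Rightarrow> (nat \<Rightarrow> ('m::finite, 'y) measurement) \<Rightarrow> (nat \<Rightarrow> 'm + 'y) \<Rightarrow> nat \<Rightarrow>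
    complex^'m^'m"
  where "density_before p U \<M> y k = C_mat p U \<M> y k /\<^sub>m trace (C_mat p U \<M> y k)"

definition density_after ::
  "'m pmf \<Rightarrow> (nat \<Rightarrow> complex^'m^'m) \<Rightarrow> (nat \<Rightarrow> ('m::finite, 'y) measurement) \<Rightarrow> (nat \<Rightarrow> 'm + 'y) \<Rightarrow> nat \<Rightarrow>
    complex^'m^'m"
  where "density_after p U \<M> y k = D_mat p U \<M> y k /\<^sub>m trace (D_mat p U \<M> y k)"

end

theory Submission
  imports Defs
begin

text \<open>
  Every measurement factor has the form \<open>K \<xi> x * cnj (K \<xi>' x')\<close>, where \<open>K\<close> is \<open>A y\<close> for a general
  measurement and the rank-one projector onto column \<open>y\<close> of \<open>B\<close> for a projective one. Hence the
  sums defining \<open>C\<^sub>k\<close> and \<open>D\<^sub>k\<close> collapse to \<open>D\<^sub>k = K\<^sub>k C\<^sub>k K\<^sub>k\<^sup>H\<close> and \<open>C\<^sub>k\<^sub>+\<^sub>1 = U\<^sub>k D\<^sub>k U\<^sub>k\<^sup>H\<close>, and the joint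
  function is \<open>tr D\<^sub>n\<close>. All these matrices are of the form \<open>G G\<^sup>H\<close>, so their traces are nonnegative, and
  completeness of the \<open>K\<^sub>k\<close> makes summation over the outcomes after time \<open>k\<close> preserve the trace, so
  that \<open>tr D\<^sub>k\<close> is the probability of \<open>y\<^sub>1, \<dots>, y\<^sub>k\<close>. The claim is then a quotient of two such traces.
\<close>

section \<open>Sums over index tuples\<close>

text \<open>Separates the last coordinate, so that it can later serve as a row or column index of a
  matrix product.\<close>

lemma sum_tuples_Suc:
  fixes f :: "(nat \<Rightarrow> 'm::finite) \<Rightarrow> 'b::comm_monoid_add"
  shows "sum f (tuples (Suc m)) = (\<Sum>x\<in>tuples m. \<Sum>b\<in>UNIV. f (x(Suc m := b)))"
proof -
  have eq: "tuples (Suc m) = (\<lambda>(b, x). x(Suc m := b)) ` (UNIV \<times> (tuples m :: (nat \<Rightarrow> 'm) set))"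
    by (simp add: tuples_def atLeastAtMostSuc_conv PiE_insert_eq)
  have inj: "inj_on (\<lambda>(b, x). x(Suc m := b)) (UNIV \<times> (tuples m :: (nat \<Rightarrow> 'm) set))"
    unfolding tuples_def by (rule inj_combinator) simp
  show ?thesis
    unfolding eq by (subst sum.reindex[OF inj], subst sum.swap)
      (simp add: sum.cartesian_product case_prod_beta)
qed

lemma tuples_0: "tuples 0 = {\<lambda>_. undefined}"
  by (simp add: tuples_def)

section \<open>Kraus operators of the measurements\<close>

text \<open>The catch-all value 0 mirrors the one of \<open>factor\<close>, so the factorization
  below holds for every \<open>y\<close>, whether or not its tag fits the measurement.\<close>

fun kraus :: "('m::finite, 'y) measurement \<Rightarrow> 'm + 'y \<Rightarrow> complex^'m^'m" where
  "kraus (Projection B) (Inl y) = (\<chi> \<xi> x. B $ \<xi> $ y * cnj (B $ x $ y))"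
| "kraus (General Y A) (Inr y) = A y"
| "kraus _ _ = 0"

lemma factor_eq_kraus:
  "factor \<M> x x' \<xi> \<xi>' y = kraus \<M> y $ \<xi> $ x * cnj (kraus \<M> y $ \<xi>' $ x')"
  by (induction \<M> x x' \<xi> \<xi>' y rule: factor.induct) (auto simp: mult_ac)

lemma hermitian_transpose_nth [simp]: "A\<^sup>H $ i $ j = cnj (A $ j $ i)"
  by (simp add: hermitian_transpose_def)

lemma hermitian_transpose_mult:
  fixes A :: "complex^'n::finite^'m" and B :: "complex^'l^'n"
  shows "(A ** B)\<^sup>H = B\<^sup>H ** A\<^sup>H"
  by (simp add: vec_eq_iff matrix_matrix_mult_def mult.commute)

text \<open>In the projective case the columns of \<open>B\<close> are unit vectors because
  \<open>B\<^sup>H ** B\<close> is the identity, hence each Kraus operator is a projector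
  \<open>K\<close> with \<open>K\<^sup>H ** K = K\<close>. These projectors add up to
  \<open>B ** B\<^sup>H\<close>, which is again the identity.\<close>

lemma kraus_complete:
  fixes \<M> :: "('m::finite, 'y) measurement"
  assumes "valid_measurement \<M>"
  shows "(\<Sum>y\<in>outcomes \<M>. (kraus \<M> y)\<^sup>H ** kraus \<M> y) = mat 1"
proof (cases \<M>)
  case (Projection B)
  have B: "B\<^sup>H ** B = mat 1" "B ** B\<^sup>H = mat 1"
    using assms Projection by (auto simp: unitary_def)
  have norm: "(\<Sum>\<xi>\<in>UNIV. cnj (B $ \<xi> $ y) * B $ \<xi> $ y) = 1" for y
    using arg_cong[OF B(1), of "\<lambda>X. X $ y $ y"]
    by (simp add: matrix_matrix_mult_def mat_def)
  have "(kraus \<M> (Inl y))\<^sup>H ** kraus \<M> (Inl y) = (\<chi> i j. B $ i $ y * cnj (B $ j $ y))" for y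
  proof -
    have "(\<Sum>\<xi>\<in>UNIV. cnj (B $ \<xi> $ y * cnj (B $ i $ y)) * (B $ \<xi> $ y * cnj (B $ j $ y)))
       = B $ i $ y * cnj (B $ j $ y) * (\<Sum>\<xi>\<in>UNIV. cnj (B $ \<xi> $ y) * B $ \<xi> $ y)" for i j
      by (simp add: sum_distrib_left mult_ac)
    then show ?thesis
      using Projection by (simp add: vec_eq_iff matrix_matrix_mult_def norm)
  qed
  moreover have "(\<Sum>y\<in>UNIV. \<chi> i j. B $ i $ y * cnj (B $ j $ y)) = mat 1"
    using B(2) by (simp add: vec_eq_iff matrix_matrix_mult_def)
  ultimately show ?thesis
    using Projection by (simp add: sum.reindex)
next
  case (General Y A)
  then show ?thesis
    using assms by (simp add: sum.reindex)
qed

lemma finite_outcomes: "valid_measurement \<M> \<Longrightarrow> finite (outcomes \<M>)"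
  by (cases \<M>) auto

section \<open>Unnormalized states and their traces\<close>

definition diag_pmf :: "'m::finite pmf \<Rightarrow> complex^'m^'m" where
  "diag_pmf p = (\<chi> i j. if i = j then of_real (pmf p i) else 0)"

text \<open>\<open>state p U \<M> y k\<close> is \<open>D\<^sub>k\<close>, extended to \<open>k = 0\<close> so that the recursion has a uniform start.\<close>

fun state :: "'m pmf \<Rightarrow> (nat \<Rightarrow> complex^'m^'m) \<Rightarrow> (nat \<Rightarrow> ('m::finite, 'y) measurement) \<Rightarrow>
    (nat \<Rightarrow> 'm + 'y) \<Rightarrow> nat \<Rightarrow> complex^'m^'m" where
  "state p U \<M> y 0 = diag_pmf p"
| "state p U \<M> y (Suc k) = kraus (\<M> (Suc k)) (y (Suc k)) **
     (U k ** state p U \<M> y k ** (U k)\<^sup>H) ** (kraus (\<M> (Suc k)) (y (Suc k)))\<^sup>H"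

text \<open>Puts a conjugation into the shape of the defining sums, so that a pair of sums over
  indices can be recognized as one.\<close>

lemma conjugation_nth:
  fixes A :: "complex^'n::finite^'m"
  shows "(A ** X ** A\<^sup>H) $ i $ j = (\<Sum>a\<in>UNIV. \<Sum>b\<in>UNIV. X $ a $ b * (A $ i $ a * cnj (A $ j $ b)))"
  by (subst sum.swap) (simp add: matrix_matrix_mult_def sum_distrib_left sum_distrib_right mult_ac)

lemma trace_sum:
  fixes f :: "'a \<Rightarrow> complex^'m^'m"
  shows "trace (sum f S) = (\<Sum>a\<in>S. trace (f a))"
  unfolding trace_def by (simp, subst sum.swap, simp)

lemma trace_unitary_conj: "unitary U \<Longrightarrow> trace (U ** X ** U\<^sup>H) = trace X"
  by (subst trace_mul_sym) (simp add: matrix_mul_assoc unitary_def)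

lemma sum_matrix_mult_right:
  fixes f :: "'a \<Rightarrow> complex^'n::finite^'m"
  shows "sum f S ** X = (\<Sum>a\<in>S. f a ** X)"
  by (simp add: vec_eq_iff matrix_matrix_mult_def sum_distrib_right, subst sum.swap, simp)

text \<open>Cyclicity of the trace brings \<open>K\<^sup>H ** K\<close> together, and completeness
  then removes the sum.\<close>

lemma trace_kraus_sum:
  assumes "valid_measurement \<M>"
  shows "(\<Sum>y\<in>outcomes \<M>. trace (kraus \<M> y ** X ** (kraus \<M> y)\<^sup>H)) = trace X"
proof -
  have "(\<Sum>y\<in>outcomes \<M>. trace (kraus \<M> y ** X ** (kraus \<M> y)\<^sup>H))
      = (\<Sum>y\<in>outcomes \<M>. trace ((kraus \<M> y)\<^sup>H ** kraus \<M> y ** X))"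
    by (subst trace_mul_sym) (simp add: matrix_mul_assoc)
  also have "\<dots> = trace X"
    by (simp flip: trace_sum sum_matrix_mult_right add: kraus_complete[OF assms])
  finally show ?thesis .
qed

text \<open>A factor \<open>G\<close> for time \<open>k\<close> becomes one for time
  \<open>k + 1\<close> after left multiplication by \<open>U k\<close> and the Kraus
  operator.\<close>

lemma state_gram:
  fixes p :: "'m::finite pmf"
  shows "\<exists>G :: complex^'m^'m. state p U \<M> y k = G ** G\<^sup>H"
proof (induction k)
  case 0
  \<comment> \<open>The real square root of the diagonal matrix of \<open>p\<close>.\<close>
  define G where "G = (\<chi> i j. if i = j then complex_of_real (sqrt (pmf p i)) else 0)"
  have "(\<Sum>l\<in>UNIV. G $ i $ l * cnj (G $ j $ l)) =
      (\<Sum>l\<in>UNIV. if l = i then if i = j then of_real (pmf p i) else 0 else 0)" for i j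
    by (rule sum.cong) (auto simp: G_def simp flip: of_real_mult)
  then have "state p U \<M> y 0 = G ** G\<^sup>H"
    by (simp add: vec_eq_iff matrix_matrix_mult_def diag_pmf_def)
  then show ?case by blast
next
  case (Suc k)
  then obtain G :: "complex^'m^'m" where "state p U \<M> y k = G ** G\<^sup>H" by blast
  then have "state p U \<M> y (Suc k)
    = (kraus (\<M> (Suc k)) (y (Suc k)) ** U k ** G) ** (kraus (\<M> (Suc k)) (y (Suc k)) ** U k ** G)\<^sup>H"
    by (simp add: hermitian_transpose_mult matrix_mul_assoc)
  then show ?case by blast
qed

text \<open>The squared Frobenius norm of \<open>G\<close>, which makes the trace real and
  nonnegative.\<close>

lemma trace_gram:
  fixes G :: "complex^'n::finite^'m"
  shows "trace (G ** G\<^sup>H) = of_real (\<Sum>i\<in>UNIV. \<Sum>j\<in>UNIV. (cmod (G $ i $ j))\<^sup>2)"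
  by (simp add: trace_def matrix_matrix_mult_def flip: complex_norm_square)

lemma trace_state:
  shows trace_state_real: "of_real (Re (trace (state p U \<M> y k))) = trace (state p U \<M> y k)"
    and trace_state_nonneg: "0 \<le> Re (trace (state p U \<M> y k))"
proof -
  obtain G :: "complex^'a^'a" where G: "state p U \<M> y k = G ** G\<^sup>H"
    using state_gram by blast
  show "of_real (Re (trace (state p U \<M> y k))) = trace (state p U \<M> y k)"
    unfolding G trace_gram by simp
  show "0 \<le> Re (trace (state p U \<M> y k))"
    unfolding G trace_gram by (simp add: sum_nonneg)
qed

lemma state_cong:
  assumes "\<And>j. j \<in> {1..k} \<Longrightarrow> y j = z j"
  shows "state p U \<M> y k = state p U \<M> z k"
  using assms by (induction k) auto

section \<open>Matrix recursions for \<open>C_mat\<close> and \<open>D_mat\<close>\<close>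

lemma sum_swap_pair:
  "(\<Sum>x\<in>R. \<Sum>b\<in>S. \<Sum>c\<in>T. g x b c) = (\<Sum>b\<in>S. \<Sum>c\<in>T. \<Sum>x\<in>R. g x b c)"
  by (subst sum.swap) (rule sum.cong[OF refl], rule sum.swap)

lemma prefix_weight_Suc:
  assumes "1 \<le> k"
  shows "prefix_weight p U \<M> y (Suc k) x0 x x' \<xi> \<xi>' = prefix_weight p U \<M> y k x0 x x' \<xi> \<xi>'
    * factor (\<M> k) (x k) (x' k) (\<xi> k) (\<xi>' k) (y k)
    * (U k $ x (Suc k) $ \<xi> k * cnj (U k $ x' (Suc k) $ \<xi>' k))"
proof -
  have "{1..Suc k - 1} = insert k {1..k - 1}" using assms by auto
  moreover have "k \<notin> {1..k - 1}" using assms by auto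
  ultimately show ?thesis
    by (simp add: prefix_weight_def mult_ac)
qed

text \<open>The evolution factor with \<open>j = k - 1\<close> reads \<open>x\<close> and
  \<open>x'\<close> at position \<open>k\<close>, whereas the other arguments are read only up to
  \<open>k - 1\<close>. Updates beyond these positions can therefore be dropped.\<close>

lemma prefix_weight_cong:
  assumes "1 \<le> k" "\<And>j. j \<in> {1..k} \<Longrightarrow> x j = z j" "\<And>j. j \<in> {1..k} \<Longrightarrow> x' j = z' j"
    "\<And>j. j \<in> {1..k-1} \<Longrightarrow> \<xi> j = \<zeta> j" "\<And>j. j \<in> {1..k-1} \<Longrightarrow> \<xi>' j = \<zeta>' j"
    "\<And>j. j \<in> {1..k-1} \<Longrightarrow> y j = w j"
  shows "prefix_weight p U \<M> y k x0 x x' \<xi> \<xi>' = prefix_weight p U \<M> w k x0 z z' \<zeta> \<zeta>'"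
proof -
  have "(\<Prod>j=1..k-1. factor (\<M> j) (x j) (x' j) (\<xi> j) (\<xi>' j) (y j)
                     * U j $ x (j + 1) $ \<xi> j * cnj (U j $ x' (j + 1) $ \<xi>' j))
      = (\<Prod>j=1..k-1. factor (\<M> j) (z j) (z' j) (\<zeta> j) (\<zeta>' j) (w j)
                     * U j $ z (j + 1) $ \<zeta> j * cnj (U j $ z' (j + 1) $ \<zeta>' j))"
    using assms by (intro prod.cong) auto
  then show ?thesis
    using assms(1) assms(2)[of 1] assms(3)[of 1] unfolding prefix_weight_def by auto
qed

text \<open>The last coordinates \<open>b\<close>, \<open>b'\<close> of the tuples \<open>x\<close>,
  \<open>x'\<close> are the free indices of \<open>C_mat\<close>. With the factor written by Kraus
  operators, summing over them is a conjugation.\<close>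

lemma D_mat_eq:
  assumes "1 \<le> k"
  shows "D_mat p U \<M> y k = kraus (\<M> k) (y k) ** C_mat p U \<M> y k ** (kraus (\<M> k) (y k))\<^sup>H"
proof -
  obtain m where k: "k = Suc m" using assms by (cases k) auto
  show ?thesis
    unfolding vec_eq_iff
  proof (intro allI)
    fix a a'
    let ?w = "\<lambda>x0 x x' \<xi> \<xi>' b b'. prefix_weight p U \<M> y k x0 (x(k := b)) (x'(k := b')) \<xi> \<xi>'
      * factor (\<M> k) b b' a a' (y k)"
    let ?T = "tuples m :: (nat \<Rightarrow> 'a) set"
    have "D_mat p U \<M> y k $ a $ a'
      = (\<Sum>x0\<in>UNIV. \<Sum>x\<in>?T. \<Sum>b\<in>UNIV. \<Sum>x'\<in>?T. \<Sum>b'\<in>UNIV. \<Sum>\<xi>\<in>?T. \<Sum>\<xi>'\<in>?T. ?w x0 x x' \<xi> \<xi>' b b')"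
      by (simp add: D_mat_def k sum_tuples_Suc)
    also have "\<dots> = (\<Sum>x0\<in>UNIV. \<Sum>b\<in>UNIV. \<Sum>b'\<in>UNIV. \<Sum>x\<in>?T. \<Sum>x'\<in>?T. \<Sum>\<xi>\<in>?T. \<Sum>\<xi>'\<in>?T. ?w x0 x x' \<xi> \<xi>' b b')"
      \<comment> \<open>In this instance \<open>sum.swap\<close> only moves a sum over
        \<open>UNIV\<close> outwards past a tuple sum.\<close>
      by (simp only: sum.swap[of _ UNIV ?T])
    also have "\<dots> = (\<Sum>b\<in>UNIV. \<Sum>b'\<in>UNIV. \<Sum>x0\<in>UNIV. \<Sum>x\<in>?T. \<Sum>x'\<in>?T. \<Sum>\<xi>\<in>?T. \<Sum>\<xi>'\<in>?T. ?w x0 x x' \<xi> \<xi>' b b')"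
      by (rule sum_swap_pair)
    also have "\<dots> = (kraus (\<M> k) (y k) ** C_mat p U \<M> y k ** (kraus (\<M> k) (y k))\<^sup>H) $ a $ a'"
      by (simp add: conjugation_nth C_mat_def k sum_distrib_right factor_eq_kraus)
    finally show "D_mat p U \<M> y k $ a $ a'
      = (kraus (\<M> k) (y k) ** C_mat p U \<M> y k ** (kraus (\<M> k) (y k))\<^sup>H) $ a $ a'" .
  qed
qed

lemma C_mat_1: "C_mat p U \<M> y 1 = U 0 ** diag_pmf p ** (U 0)\<^sup>H"
proof -
  have diag: "diag_pmf p $ i $ j * (U 0 $ a $ i * cnj (U 0 $ a' $ j)) =
      (if i = j then of_real (pmf p i) * U 0 $ a $ i * cnj (U 0 $ a' $ i) else 0)" for i j a a'
    by (simp add: diag_pmf_def)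
  show ?thesis
    unfolding vec_eq_iff conjugation_nth diag
    by (simp add: C_mat_def tuples_0 prefix_weight_def)
qed

text \<open>Here the coordinates split off are those of \<xi> and \<xi>' at \<open>k\<close>, the
  free indices of \<open>D_mat\<close>; the tuples \<open>x\<close>, \<open>x'\<close> of length
  \<open>k\<close> occur in both matrices.\<close>

lemma C_mat_Suc:
  assumes "1 \<le> k"
  shows "C_mat p U \<M> y (Suc k) = U k ** D_mat p U \<M> y k ** (U k)\<^sup>H"
proof -
  obtain m where k: "k = Suc m" using assms by (cases k) auto
  show ?thesis
    unfolding vec_eq_iff
  proof (intro allI)
    fix a a'
    let ?w = "\<lambda>x0 x x' \<xi> \<xi>' b b'. prefix_weight p U \<M> y k x0 x x' \<xi> \<xi>'
      * factor (\<M> k) (x k) (x' k) b b' (y k) * (U k $ a $ b * cnj (U k $ a' $ b'))"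
    let ?T = "tuples m :: (nat \<Rightarrow> 'a) set" and ?S = "tuples k :: (nat \<Rightarrow> 'a) set"
    \<comment> \<open>The inserted values reach only the measurement factor and the evolution factor
      at time \<open>k\<close>, not the weight before it.\<close>
    have w: "prefix_weight p U \<M> y (Suc k) x0 (x(Suc k := a)) (x'(Suc k := a')) (\<xi>(k := b)) (\<xi>'(k := b'))
        = ?w x0 x x' \<xi> \<xi>' b b'" for x0 x x' \<xi> \<xi>' b b'
    proof -
      have "prefix_weight p U \<M> y k x0 (x(Suc k := a)) (x'(Suc k := a')) (\<xi>(k := b)) (\<xi>'(k := b'))
        = prefix_weight p U \<M> y k x0 x x' \<xi> \<xi>'"
        using assms by (intro prefix_weight_cong) auto
      then show ?thesis
        unfolding prefix_weight_Suc[OF assms] by simp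
    qed
    have "C_mat p U \<M> y (Suc k) $ a $ a'
      = (\<Sum>x0\<in>UNIV. \<Sum>x\<in>?S. \<Sum>x'\<in>?S. \<Sum>\<xi>\<in>?T. \<Sum>b\<in>UNIV. \<Sum>\<xi>'\<in>?T. \<Sum>b'\<in>UNIV. ?w x0 x x' \<xi> \<xi>' b b')"
      unfolding C_mat_def
      by (simp add: sum_tuples_Suc[of _ m, folded k] w)
    also have "\<dots> = (\<Sum>x0\<in>UNIV. \<Sum>b\<in>UNIV. \<Sum>b'\<in>UNIV. \<Sum>x\<in>?S. \<Sum>x'\<in>?S. \<Sum>\<xi>\<in>?T. \<Sum>\<xi>'\<in>?T. ?w x0 x x' \<xi> \<xi>' b b')"
      by (simp only: sum.swap[of _ UNIV ?T] sum.swap[of _ UNIV ?S])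
    also have "\<dots> = (\<Sum>b\<in>UNIV. \<Sum>b'\<in>UNIV. \<Sum>x0\<in>UNIV. \<Sum>x\<in>?S. \<Sum>x'\<in>?S. \<Sum>\<xi>\<in>?T. \<Sum>\<xi>'\<in>?T. ?w x0 x x' \<xi> \<xi>' b b')"
      by (rule sum_swap_pair)
    also have "\<dots> = (U k ** D_mat p U \<M> y k ** (U k)\<^sup>H) $ a $ a'"
      by (simp add: conjugation_nth D_mat_def k sum_distrib_right)
    finally show "C_mat p U \<M> y (Suc k) $ a $ a' = (U k ** D_mat p U \<M> y k ** (U k)\<^sup>H) $ a $ a'" .
  qed
qed

lemma C_mat_eq_state: "C_mat p U \<M> y (Suc k) = U k ** state p U \<M> y k ** (U k)\<^sup>H"
proof (induction k)
  case 0
  show ?case using C_mat_1 by simp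
next
  case (Suc k)
  then show ?case by (simp add: C_mat_Suc D_mat_eq)
qed

lemma D_mat_eq_state: "D_mat p U \<M> y (Suc k) = state p U \<M> y (Suc k)"
  by (simp add: D_mat_eq C_mat_eq_state)

text \<open>The final equality constraint identifies the two free indices of \<open>D_mat\<close> at
  time \<open>n\<close>, which turns the sum over them into a trace.\<close>

lemma joint_function_eq_trace:
  assumes "1 \<le> n"
  shows "joint_function n p U \<M> y = trace (state p U \<M> y n)"
proof -
  obtain m where n: "n = Suc m" using assms by (cases n) auto
  let ?w = "\<lambda>x0 x x' \<xi> \<xi>' b b'. prefix_weight p U \<M> y n x0 x x' \<xi> \<xi>'
      * factor (\<M> n) (x n) (x' n) b b' (y n)"
  let ?T = "tuples m :: (nat \<Rightarrow> 'a) set" and ?S = "tuples n :: (nat \<Rightarrow> 'a) set"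
  \<comment> \<open>There is one measurement factor more than there are evolution factors after
    \<open>U 0\<close>: the first \<open>n - 1\<close> pairs form the prefix weight, and the
    \<open>n\<close>-th measurement factor is left over.\<close>
  have w: "of_real (pmf p x0) * U 0 $ x 1 $ x0 * cnj (U 0 $ x' 1 $ x0)
      * (\<Prod>j=1..n. factor (\<M> j) (x j) (x' j) ((\<xi>(n := b)) j) ((\<xi>'(n := b')) j) (y j))
      * (\<Prod>j=1..<n. U j $ x (j + 1) $ (\<xi>(n := b)) j * cnj (U j $ x' (j + 1) $ (\<xi>'(n := b')) j))
      * f_eq ((\<xi>(n := b)) n) ((\<xi>'(n := b')) n) = (if b = b' then ?w x0 x x' \<xi> \<xi>' b b' else 0)"
    for x0 x x' \<xi> \<xi>' b b'
  proof -
    have "prefix_weight p U \<M> y n x0 x x' \<xi> \<xi>' = prefix_weight p U \<M> y n x0 x x' (\<xi>(n := b)) (\<xi>'(n := b'))"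
      using assms by (intro prefix_weight_cong) auto
    moreover have "{1..<n} = {1..m}" "{1..n} = insert n {1..m}" "n \<notin> {1..m}"
      using n by auto
    ultimately show ?thesis
      by (simp add: prefix_weight_def prod.distrib f_eq_def n mult_ac)
  qed
  have "joint_function n p U \<M> y
    = (\<Sum>x0\<in>UNIV. \<Sum>x\<in>?S. \<Sum>x'\<in>?S. \<Sum>\<xi>\<in>?T. \<Sum>b\<in>UNIV. \<Sum>\<xi>'\<in>?T. ?w x0 x x' \<xi> \<xi>' b b)"
    unfolding joint_function_def sum_tuples_Suc[of _ m, folded n] w by simp
  also have "\<dots> = (\<Sum>x0\<in>UNIV. \<Sum>b\<in>UNIV. \<Sum>x\<in>?S. \<Sum>x'\<in>?S. \<Sum>\<xi>\<in>?T. \<Sum>\<xi>'\<in>?T. ?w x0 x x' \<xi> \<xi>' b b)"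
    by (simp only: sum.swap[of _ UNIV ?T] sum.swap[of _ UNIV ?S])
  also have "\<dots> = (\<Sum>b\<in>UNIV. \<Sum>x0\<in>UNIV. \<Sum>x\<in>?S. \<Sum>x'\<in>?S. \<Sum>\<xi>\<in>?T. \<Sum>\<xi>'\<in>?T. ?w x0 x x' \<xi> \<xi>' b b)"
    by (rule sum.swap)
  also have "\<dots> = trace (D_mat p U \<M> y n)"
    by (simp add: trace_def D_mat_def n)
  finally show ?thesis
    by (simp only: n D_mat_eq_state)
qed

section \<open>Summing out later outcomes\<close>

definition outcome_space :: "nat \<Rightarrow> (nat \<Rightarrow> ('m::finite, 'y) measurement) \<Rightarrow> (nat \<Rightarrow> 'm + 'y) set" where
  "outcome_space n \<M> = (\<Pi>\<^sub>E j\<in>{1..n}. outcomes (\<M> j))"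

lemma sum_outcome_space_Suc:
  "sum f (outcome_space (Suc m) \<M>) =
    (\<Sum>y\<in>outcome_space m \<M>. \<Sum>b\<in>outcomes (\<M> (Suc m)). f (y(Suc m := b)))"
proof -
  have eq: "outcome_space (Suc m) \<M> =
      (\<lambda>(b, y). y(Suc m := b)) ` (outcomes (\<M> (Suc m)) \<times> outcome_space m \<M>)"
    by (simp add: outcome_space_def atLeastAtMostSuc_conv PiE_insert_eq)
  have inj: "inj_on (\<lambda>(b, y). y(Suc m := b)) (outcomes (\<M> (Suc m)) \<times> outcome_space m \<M>)"
    unfolding outcome_space_def by (rule inj_combinator) simp
  show ?thesis
    unfolding eq by (subst sum.reindex[OF inj], subst sum.swap)
      (simp add: sum.cartesian_product case_prod_beta)
qed

lemma finite_outcome_space: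
  assumes "\<And>j. j \<in> {1..n} \<Longrightarrow> valid_measurement (\<M> j)"
  shows "finite (outcome_space n \<M>)"
  unfolding outcome_space_def using assms by (intro finite_PiE) (auto intro: finite_outcomes)

lemma sum_trace_state_Suc:
  assumes "valid_measurement (\<M> (Suc m))" "unitary (U m)"
  shows "(\<Sum>b\<in>outcomes (\<M> (Suc m)). trace (state p U \<M> (y(Suc m := b)) (Suc m))) = trace (state p U \<M> y m)"
proof -
  have "state p U \<M> (y(Suc m := b)) m = state p U \<M> y m" for b
    by (rule state_cong) simp
  then show ?thesis
    using assms by (simp add: trace_kraus_sum trace_unitary_conj)
qed

text \<open>Induction on \<open>n\<close> starting at \<open>k\<close>: each later measurement,
  summed over its outcomes, leaves the trace unchanged.\<close>

lemma sum_trace_state: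
  assumes "\<And>j. j < n \<Longrightarrow> unitary (U j)"
    and "\<And>j. j \<in> {1..n} \<Longrightarrow> valid_measurement (\<M> j)"
    and "k \<le> n" and z: "\<And>j. j \<in> {1..k} \<Longrightarrow> z j \<in> outcomes (\<M> j)"
  shows "(\<Sum>y\<in>outcome_space n \<M>. if \<forall>j\<in>{1..k}. y j = z j then trace (state p U \<M> y n) else 0)
    = trace (state p U \<M> z k)"
  using \<open>k \<le> n\<close> assms(1,2)
proof (induction n rule: dec_induct)
  case base
  \<comment> \<open>Outcome tuples are extensional, so this restriction is the only one that agrees
    with \<open>z\<close> on all \<open>k\<close> coordinates.\<close>
  let ?z = "restrict z {1..k}"
  have "y \<in> outcome_space k \<M> \<and> (\<forall>j\<in>{1..k}. y j = z j) \<longleftrightarrow> y = ?z" for y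
    using z by (auto simp: outcome_space_def PiE_def Pi_def extensional_def)
  then have "{y \<in> outcome_space k \<M>. \<forall>j\<in>{1..k}. y j = z j} = {?z}"
    by blast
  moreover have "finite (outcome_space k \<M>)"
    using base by (intro finite_outcome_space)
  moreover have "state p U \<M> ?z k = state p U \<M> z k"
    by (rule state_cong) simp
  ultimately show ?case
    by (simp add: sum.inter_filter[symmetric])
next
  case (step m)
  have "(\<Sum>b\<in>outcomes (\<M> (Suc m)). if \<forall>j\<in>{1..k}. (y(Suc m := b)) j = z j
           then trace (state p U \<M> (y(Suc m := b)) (Suc m)) else 0)
      = (if \<forall>j\<in>{1..k}. y j = z j then trace (state p U \<M> y m) else 0)" for y
  proof -
    have eq: "(\<forall>j\<in>{1..k}. (y(Suc m := b)) j = z j) \<longleftrightarrow> (\<forall>j\<in>{1..k}. y j = z j)" for b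
      using step.hyps by auto
    show ?thesis
    proof (cases "\<forall>j\<in>{1..k}. y j = z j")
      case True
      then show ?thesis
        using sum_trace_state_Suc[of \<M> m U p y] step.prems by (simp only: eq if_True) simp
    next
      case False
      then show ?thesis
        by (simp only: eq if_False sum.neutral_const)
    qed
  qed
  then show ?case
    using step by (simp add: sum_outcome_space_Suc del: state.simps)
qed

lemma trace_diag_pmf: "trace (diag_pmf p) = 1"
proof -
  have "(\<Sum>i\<in>UNIV. pmf p i) = 1"
    by (rule sum_pmf_eq_1) auto
  then show ?thesis
    by (simp add: trace_def diag_pmf_def flip: of_real_sum)
qed

section \<open>The joint distribution and its prefix probabilities\<close>

locale quantum_system =
  fixes n :: nat
    and p :: "'m::finite pmf"
    and U :: "nat \<Rightarrow> complex^'m^'m"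
    and \<M> :: "nat \<Rightarrow> ('m, 'y) measurement"
  assumes n_pos: "1 \<le> n"
    and unitary_evolution: "\<And>j. j < n \<Longrightarrow> unitary (U j)"
    and valid: "\<And>j. j \<in> {1..n} \<Longrightarrow> valid_measurement (\<M> j)"
begin

text \<open>Justifies \<open>embed_pmf\<close>: the masses are nonnegative as traces of Gram
  matrices, and they sum to the trace of the initial state.\<close>

lemma pmf_joint_pmf:
  shows "pmf (joint_pmf n p U \<M>) y
    = (if y \<in> outcome_space n \<M> then Re (trace (state p U \<M> y n)) else 0)"
proof -
  let ?f = "\<lambda>y. if y \<in> outcome_space n \<M> then Re (trace (state p U \<M> y n)) else 0"
  have fin: "finite (outcome_space n \<M>)"
    using valid by (rule finite_outcome_space)
  \<comment> \<open>The case \<open>k = 0\<close> of \<open>sum_trace_state\<close>: the prefix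
    condition is vacuous, so any \<open>z\<close> serves.\<close>
  have "(\<Sum>y\<in>outcome_space n \<M>. trace (state p U \<M> y n)) = 1"
    using sum_trace_state[of n U \<M> 0 undefined p] unitary_evolution valid by (simp add: trace_diag_pmf)
  then have sum1: "(\<Sum>y\<in>outcome_space n \<M>. Re (trace (state p U \<M> y n))) = 1"
    by (simp flip: Re_sum)
  have "(\<integral>\<^sup>+y. ennreal (?f y) \<partial>count_space UNIV) = (\<Sum>y\<in>outcome_space n \<M>. ennreal (?f y))"
    by (rule nn_integral_count_space') (use fin in auto)
  also have "\<dots> = 1"
    by (simp add: sum_ennreal trace_state_nonneg sum1)
  finally have "(\<integral>\<^sup>+y. ennreal (?f y) \<partial>count_space UNIV) = 1" .
  moreover have "joint_pmf n p U \<M> = embed_pmf ?f"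
    by (simp only: joint_pmf_def joint_function_eq_trace[OF n_pos] outcome_space_def)
  ultimately show ?thesis
    by (simp add: pmf_embed_pmf trace_state_nonneg)
qed

lemma set_joint_pmf: "set_pmf (joint_pmf n p U \<M>) \<subseteq> outcome_space n \<M>"
  by (auto simp: set_pmf_iff pmf_joint_pmf split: if_splits)

lemma prob_prefix:
  assumes "k \<le> n" and "\<And>j. j \<in> {1..k} \<Longrightarrow> z j \<in> outcomes (\<M> j)"
  shows "complex_of_real (\<P>(Y in joint_pmf n p U \<M>. \<forall>j\<in>{1..k}. Y j = z j)) = trace (state p U \<M> z k)"
proof -
  let ?J = "joint_pmf n p U \<M>" and ?O = "outcome_space n \<M>"
  let ?S = "{Y. \<forall>j\<in>{1..k}. Y j = z j}"
  have fin: "finite ?O"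
    using valid by (rule finite_outcome_space)
  \<comment> \<open>Tuples outside the outcome space carry no mass; the intersection is finite, so
    the probability becomes a finite sum.\<close>
  have "\<P>(Y in ?J. \<forall>j\<in>{1..k}. Y j = z j) = measure ?J (?S \<inter> ?O)"
    using set_joint_pmf
    by (auto intro!: measure_pmf.finite_measure_eq_AE AE_pmfI)
  also have "\<dots> = (\<Sum>y\<in>?S \<inter> ?O. pmf ?J y)"
    using fin by (simp add: measure_measure_pmf_finite)
  also have "\<dots> = (\<Sum>y\<in>?S \<inter> ?O. Re (trace (state p U \<M> y n)))"
    by (intro sum.cong) (auto simp: pmf_joint_pmf)
  finally have "complex_of_real (\<P>(Y in ?J. \<forall>j\<in>{1..k}. Y j = z j)) = (\<Sum>y\<in>?S \<inter> ?O. trace (state p U \<M> y n))"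
    by (simp add: trace_state_real)
  also have "?S \<inter> ?O = {y \<in> ?O. \<forall>j\<in>{1..k}. y j = z j}"
    by auto
  finally show ?thesis
    using sum_trace_state[of n U \<M> k z p] unitary_evolution valid assms by (simp add: sum.inter_filter[OF fin])
qed

end

section \<open>Conditional probability and normalized states\<close>

lemma matrix_div_conj:
  fixes A :: "complex^'n::finite^'m"
  shows "A ** (X /\<^sub>m c) ** A\<^sup>H = (A ** X ** A\<^sup>H) /\<^sub>m c"
  unfolding vec_eq_iff by (auto simp: matrix_div_def conjugation_nth[unfolded vec_eq_iff] sum_divide_distrib)

lemma trace_matrix_div: "trace (X /\<^sub>m c) = trace X / c"
  by (simp add: trace_def matrix_div_def sum_divide_distrib)

theorem proposition5:
  fixes n k :: nat
    and p :: "'m::finite pmf"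
    and U :: "nat \<Rightarrow> complex^'m^'m"
    and \<M> :: "nat \<Rightarrow> ('m, 'y) measurement"
    and \<Y> :: "'y set"
    and A :: "'y \<Rightarrow> complex^'m^'m"
    and ys :: "nat \<Rightarrow> 'm + 'y"
  assumes "n \<ge> 1"
    and "\<And>j. j < n \<Longrightarrow> unitary (U j)"
    and "\<And>j. j \<in> {1..n} \<Longrightarrow> valid_measurement (\<M> j)"
    and "1 \<le> k" and "k \<le> n"
    and "\<M> k = General \<Y> A"
    and "\<P>(Y in joint_pmf n p U \<M>. \<forall>j\<in>{1..k-1}. Y j = ys j) > 0"
  shows "\<forall>y\<in>\<Y>.
      complex_of_real (\<P>(Y in joint_pmf n p U \<M>. Y k = Inr y \<bar> \<forall>j\<in>{1..k-1}. Y j = ys j))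
        = trace (A y ** density_before p U \<M> ys k ** (A y)\<^sup>H)
      \<and> (\<P>(Y in joint_pmf n p U \<M>. Y k = Inr y \<bar> \<forall>j\<in>{1..k-1}. Y j = ys j) > 0 \<longrightarrow>
          density_after p U \<M> (ys(k := Inr y)) k
            = (A y ** density_before p U \<M> ys k ** (A y)\<^sup>H)
              /\<^sub>m trace (A y ** density_before p U \<M> ys k ** (A y)\<^sup>H))"
proof
  interpret quantum_system n p U \<M>
    using assms(1-3) by unfold_locales
  fix y assume y: "y \<in> \<Y>"
  let ?J = "joint_pmf n p U \<M>" and ?C = "C_mat p U \<M> ys k" and ?z = "ys(k := Inr y)"
  let ?D = "A y ** ?C ** (A y)\<^sup>H"
  obtain m where k: "k = Suc m" using \<open>1 \<le> k\<close> by (cases k) auto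
  \<comment> \<open>A conditioning event of positive probability meets the support, so the past
    values are genuine outcomes. This matters because \<open>A y\<close> is unconstrained for
    \<open>y\<close> outside the outcome set.\<close>
  have "\<exists>Y\<in>set_pmf ?J. \<forall>j\<in>{1..k-1}. Y j = ys j"
  proof (rule ccontr)
    assume "\<not> ?thesis"
    then have "\<P>(Y in ?J. \<forall>j\<in>{1..k-1}. Y j = ys j) = 0"
      by (intro measure_pmf.prob_eq_0_AE AE_pmfI) auto
    with assms(7) show False by simp
  qed
  then have ys: "ys j \<in> outcomes (\<M> j)" if "j \<in> {1..k-1}" for j
    using set_joint_pmf that \<open>k \<le> n\<close>
    by (force simp: outcome_space_def PiE_def Pi_def)
  have C: "?C = U m ** state p U \<M> ys m ** (U m)\<^sup>H"
    by (simp add: k C_mat_eq_state)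
  have trC: "trace ?C = of_real (\<P>(Y in ?J. \<forall>j\<in>{1..k-1}. Y j = ys j))"
    unfolding C using prob_prefix[of m ys] ys \<open>k \<le> n\<close> assms(2)[of m]
    by (simp add: k trace_unitary_conj)
  then have trC_nz: "trace ?C \<noteq> 0"
    using assms(7) by simp
  \<comment> \<open>Changing the outcome at time \<open>k\<close> does not affect the state after
    time \<open>m = k - 1\<close>.\<close>
  have st: "state p U \<M> ?z m = state p U \<M> ys m"
    by (rule state_cong) (simp add: k)
  have D: "D_mat p U \<M> ?z k = ?D" "state p U \<M> ?z k = ?D"
    using assms(6) st by (simp_all add: k D_mat_eq_state C_mat_eq_state)
  have "(\<forall>j\<in>{1..k}. Y j = ?z j) \<longleftrightarrow> Y k = Inr y \<and> (\<forall>j\<in>{1..k-1}. Y j = ys j)" for Y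
  proof -
    have "{1..k} = insert k {1..k-1}" "k \<notin> {1..k-1}" using k by auto
    then show ?thesis by auto
  qed
  moreover have "?z j \<in> outcomes (\<M> j)" if "j \<in> {1..k}" for j
    using that y ys[of j] assms(6) by auto
  ultimately have trD: "trace ?D = of_real (\<P>(Y in ?J. Y k = Inr y \<and> (\<forall>j\<in>{1..k-1}. Y j = ys j)))"
    using prob_prefix[OF assms(5), of ?z] by (simp add: D)
  let ?P = "\<P>(Y in ?J. Y k = Inr y \<bar> \<forall>j\<in>{1..k-1}. Y j = ys j)"
  have rho: "A y ** density_before p U \<M> ys k ** (A y)\<^sup>H = ?D /\<^sub>m trace ?C"
    by (simp add: density_before_def matrix_div_conj)
  have "complex_of_real ?P = trace ?D / trace ?C"
    by (simp add: cond_prob_def trC trD)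
  \<comment> \<open>The nonzero factor \<open>trace ?C\<close> cancels between the matrix and its
    normalization.\<close>
  moreover have "density_after p U \<M> ?z k = (?D /\<^sub>m trace ?C) /\<^sub>m (trace ?D / trace ?C)"
    using trC_nz by (simp add: density_after_def D matrix_div_def)
  ultimately show "complex_of_real ?P = trace (A y ** density_before p U \<M> ys k ** (A y)\<^sup>H)
      \<and> (?P > 0 \<longrightarrow> density_after p U \<M> ?z k
            = (A y ** density_before p U \<M> ys k ** (A y)\<^sup>H)
              /\<^sub>m trace (A y ** density_before p U \<M> ys k ** (A y)\<^sup>H))"
    by (simp add: rho trace_matrix_div)
qed

end
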